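(* For $n \ge 2$, let $K_n$ be the complete graph on $n$ vertices and consider its subtrees having at least one edge. (1) Let $p_n$ be the probability that a subtree of $K_n$ chosen uniformly at random (every subtree equally likely) is a spanning tree of $K_n$. Then $\lim_{n\to\infty} p_n = e^{-e^{-1}} = 0.692201\dots$. (2) Let $q_n$ be the probability that a subtree of $K_n$ chosen with weighted probability (the probability of choosing a subtree $T$ is proportional to its number of edges $|E(T)|$) is a spanning tree of $K_n$. Then $\lim_{n\to\infty} q_n = e^{-e^{-1}}$.
   Context: A subtree of a graph $G$ is a subgraph that is a tree; here only subtrees with at least one edge are counted. Equivalently, with $a_k=\binom{n}{k+1}(k+1)^{k-1}$ the number of $k$-edge subtrees of $K_n$, $p_n = a_{n-1}/\sum_{k=1}^{n-1}a_k$ and $q_n = (n-1)a_{n-1}/\sum_{k=1}^{n-1}k a_k$. *)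

theory Defs
  imports "HOL-Probability.Probability"
begin

(* Undirected simple graphs as pairs of a vertex set and a set of two-element edges. The trees of
   AFP Graph_Theory are not usable here: in a symmetric digraph every edge a-b already yields the
   directed cycle a,b,a. *)

type_synonym 'a ugraph = "'a set \<times> 'a set set"

abbreviation verts :: "'a ugraph \<Rightarrow> 'a set" where "verts \<equiv> fst"

abbreviation edges :: "'a ugraph \<Rightarrow> 'a set set" where "edges \<equiv> snd"

definition simple_graph :: "'a ugraph \<Rightarrow> bool" where
  "simple_graph G \<longleftrightarrow> (\<forall>e \<in> edges G. e \<subseteq> verts G \<and> card e = 2)"

definition complete_graph :: "nat \<Rightarrow> nat ugraph" where
  "complete_graph n = ({1..n}, {e. e \<subseteq> {1..n} \<and> card e = 2})"

definition subgraph :: "'a ugraph \<Rightarrow> 'a ugraph \<Rightarrow> bool" where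
  "subgraph H G \<longleftrightarrow> simple_graph H \<and> verts H \<subseteq> verts G \<and> edges H \<subseteq> edges G"

definition walk :: "'a ugraph \<Rightarrow> 'a list \<Rightarrow> bool" where
  "walk G p \<longleftrightarrow> p \<noteq> [] \<and> set p \<subseteq> verts G \<and> successively (\<lambda>u v. {u, v} \<in> edges G) p"

definition graph_connected :: "'a ugraph \<Rightarrow> bool" where
  "graph_connected G \<longleftrightarrow>
     verts G \<noteq> {} \<and> (\<forall>u \<in> verts G. \<forall>v \<in> verts G. \<exists>p. walk G p \<and> hd p = u \<and> last p = v)"

(* A cycle is given by the list of its distinct vertices, the closing edge joining last and first. *)

definition graph_cycle :: "'a ugraph \<Rightarrow> 'a list \<Rightarrow> bool" where
  "graph_cycle G c \<longleftrightarrow> walk G c \<and> distinct c \<and> length c \<ge> 3 \<and> {last c, hd c} \<in> edges G"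

definition is_tree :: "'a ugraph \<Rightarrow> bool" where
  "is_tree T \<longleftrightarrow> simple_graph T \<and> graph_connected T \<and> (\<nexists>c. graph_cycle T c)"

definition subtrees :: "'a ugraph \<Rightarrow> 'a ugraph set" where
  "subtrees G = {T. subgraph T G \<and> is_tree T \<and> card (edges T) \<ge> 1}"

definition spanning_trees :: "'a ugraph \<Rightarrow> 'a ugraph set" where
  "spanning_trees G = {T. subgraph T G \<and> is_tree T \<and> verts T = verts G}"

(* The distribution on a finite set A giving each element probability proportional to its weight;
   embed_pmf is meaningful only under the hypotheses of the lemma that follows. *)

definition proportional_pmf :: "'a set \<Rightarrow> ('a \<Rightarrow> real) \<Rightarrow> 'a pmf" where
  "proportional_pmf A w = embed_pmf (\<lambda>x. if x \<in> A then w x / (\<Sum>y\<in>A. w y) else 0)"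

lemma pmf_proportional_pmf:
  assumes A: "finite A" and w: "\<And>x. x \<in> A \<Longrightarrow> w x \<ge> 0" and s: "(\<Sum>y\<in>A. w y) > 0"
  shows "pmf (proportional_pmf A w) x = (if x \<in> A then w x / (\<Sum>y\<in>A. w y) else 0)"
  unfolding proportional_pmf_def
proof (rule pmf_embed_pmf)
  let ?f = "\<lambda>x. if x \<in> A then w x / (\<Sum>y\<in>A. w y) else 0"
  show nn: "0 \<le> ?f x" for x using w s by auto
  have "(\<integral>\<^sup>+x. ennreal (?f x) \<partial>count_space UNIV) = (\<Sum>x\<in>A. ennreal (?f x))"
    by (rule nn_integral_count_space'[OF A]) auto
  also have "\<dots> = ennreal (\<Sum>x\<in>A. ?f x)" by (rule sum_ennreal) (rule nn)
  also have "(\<Sum>x\<in>A. ?f x) = 1" using s by (simp add: sum_divide_distrib[symmetric])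
  finally show "(\<integral>\<^sup>+x. ennreal (?f x) \<partial>count_space UNIV) = 1" by simp
qed

lemma finite_subtrees_complete_graph: "finite (subtrees (complete_graph n))"
proof (rule finite_subset)
  show "subtrees (complete_graph n) \<subseteq> Pow {1..n} \<times> Pow (Pow {1..n})"
    by (auto simp: subtrees_def subgraph_def complete_graph_def)
  show "finite (Pow {1..n} \<times> Pow (Pow {1..n}))" by simp
qed

lemma subtrees_complete_graph_nonempty:
  assumes "n \<ge> 2"
  shows "subtrees (complete_graph n) \<noteq> {}"
proof -
  let ?T = "({1, 2}, {{1, 2}}) :: nat ugraph"
  have sg: "simple_graph ?T" by (simp add: simple_graph_def)
  have "subgraph ?T (complete_graph n)"
    using assms sg by (auto simp: subgraph_def complete_graph_def)
  moreover have "graph_connected ?T"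
  proof -
    have "walk ?T [1]" "walk ?T [2]" "walk ?T [1, 2]" "walk ?T [2, 1]"
      by (auto simp: walk_def insert_commute)
    then have "\<exists>p. walk ?T p \<and> hd p = u \<and> last p = v" if "u \<in> {1, 2}" "v \<in> {1, 2}" for u v :: nat
      using that by (metis insertE singletonD list.sel(1) last.simps list.distinct(1))
    then show ?thesis by (simp add: graph_connected_def)
  qed
  moreover have "\<not> graph_cycle ?T c" for c
  proof
    assume c: "graph_cycle ?T c"
    then have "card (set c) \<ge> 3" by (auto simp: graph_cycle_def distinct_card)
    moreover have "card (set c) \<le> card {1, 2 :: nat}"
      using c by (intro card_mono) (auto simp: graph_cycle_def walk_def)
    ultimately show False by simp
  qed
  ultimately have "?T \<in> subtrees (complete_graph n)"
    using sg by (simp add: subtrees_def is_tree_def)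
  then show ?thesis by blast
qed

lemma pmf_subtree_by_edges:
  assumes "n \<ge> 2" and "T \<in> subtrees (complete_graph n)"
  shows "pmf (proportional_pmf (subtrees (complete_graph n)) (\<lambda>T. card (edges T))) T
    = card (edges T) / (\<Sum>S\<in>subtrees (complete_graph n). card (edges S))"
proof -
  have "(\<Sum>S\<in>subtrees (complete_graph n). real (card (edges S))) > 0"
    using finite_subtrees_complete_graph subtrees_complete_graph_nonempty[OF assms(1)]
    by (intro sum_pos) (auto simp: subtrees_def)
  with assms show ?thesis
    by (subst pmf_proportional_pmf) (auto simp: finite_subtrees_complete_graph)
qed

definition prob_spanning_uniform :: "nat \<Rightarrow> real" where
  "prob_spanning_uniform n = measure_pmf.prob (pmf_of_set (subtrees (complete_graph n)))
           (spanning_trees (complete_graph n))"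

definition prob_spanning_weighted :: "nat \<Rightarrow> real" where
  "prob_spanning_weighted n = measure_pmf.prob
           (proportional_pmf (subtrees (complete_graph n)) (\<lambda>T. real (card (edges T))))
           (spanning_trees (complete_graph n))"

end

(* Cayley's formula t(n) = n^(n-2) is obtained by inclusion-exclusion over the leaves different from
   a root r. A tree on V in which all vertices of S are leaves arises from a tree on V - S by
   attaching each vertex of S to V - S, so there are (n-k)^k t(n-k) of them, k = |S|. Every tree with
   at least two vertices has a leaf other than r, so the alternating sum over S of these counts
   vanishes; so does the alternating sum of (n-k)^(n-2), which is an (n-1)-st finite difference of a
   polynomial of degree n-2. By induction the terms with S nonempty agree, hence those with S empty.

   Dividing the number of subtrees with n-j vertices by n^(n-2) gives a ratio that is at most 1/j!
   and tends to e^(-j)/j!. By Tannery's theorem the sum over j tends to e^(1/e), which is the inverse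
   of both limits, as the edge weights (n-j-1)/(n-1) are at most 1 and tend to 1. *)

theory Submission
  imports Defs "HOL-Real_Asymp.Real_Asymp"
begin

section \<open>Alternating sums over subsets\<close>

lemma sum_Pow_insert:
  assumes "finite A" "a \<notin> A"
  shows "(\<Sum>S\<in>Pow (insert a A). g S) = (\<Sum>S\<in>Pow A. g S + g (insert a S))"
proof -
  have "(\<Sum>S\<in>Pow (insert a A). g S) = sum g (Pow A) + sum g (insert a ` Pow A)"
    unfolding Pow_insert using assms by (intro sum.union_disjoint) auto
  also have "sum g (insert a ` Pow A) = (\<Sum>S\<in>Pow A. g (insert a S))"
    using assms(2) by (subst sum.reindex) (auto simp: inj_on_def)
  finally show ?thesis by (simp add: sum.distrib)
qed

text \<open>Each element of \<open>A\<close> acts as one finite difference on \<open>y ^ d\<close>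
  and lowers the degree, so nothing survives once there are more elements than the degree. The
  induction varies \<open>c\<close> and \<open>d\<close>, as a difference shifts the base and
  produces all lower powers.\<close>

lemma alternating_sum_Pow_power:
  fixes c :: "'b :: comm_ring_1"
  assumes "finite A" "d < card A"
  shows "(\<Sum>S\<in>Pow A. (-1) ^ card S * (c - of_nat (card S)) ^ d) = 0"
  using assms
proof (induction A arbitrary: d c)
  case empty
  then show ?case by simp
next
  case (insert a A)
  have fS: "finite S" "a \<notin> S" if "S \<in> Pow A" for S
    using that insert.hyps finite_subset by auto
  \<comment> \<open>The top power cancels, so only exponents \<open>i < d\<close> remain; they stay
    below \<open>card A\<close> once \<open>a\<close> is removed.\<close>
  have diff: "(y + 1) ^ d - y ^ d = (\<Sum>i<d. of_nat (d choose i) * y ^ i)" for y :: 'b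
    by (simp add: binomial_ring[of y 1 d] lessThan_Suc_atMost[symmetric])
  \<comment> \<open>Pairing \<open>S\<close> with \<open>insert a S\<close>, which carries the
    opposite sign, turns each pair into a difference at \<open>c - 1 - card S\<close>.\<close>
  have "(\<Sum>S\<in>Pow (insert a A). (-1) ^ card S * (c - of_nat (card S)) ^ d)
      = (\<Sum>S\<in>Pow A. (-1) ^ card S * (((c - 1 - of_nat (card S)) + 1) ^ d - (c - 1 - of_nat (card S)) ^ d))"
    unfolding sum_Pow_insert[OF insert.hyps]
    by (intro sum.cong refl) (auto simp: fS algebra_simps)
  also have "\<dots> = (\<Sum>S\<in>Pow A. \<Sum>i<d. of_nat (d choose i) * ((-1) ^ card S * (c - 1 - of_nat (card S)) ^ i))"
    unfolding diff by (simp add: sum_distrib_left algebra_simps)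
  also have "\<dots> = (\<Sum>i<d. of_nat (d choose i) * (\<Sum>S\<in>Pow A. (-1) ^ card S * (c - 1 - of_nat (card S)) ^ i))"
    by (subst sum.swap) (simp add: sum_distrib_left)
  also have "\<dots> = 0"
  proof (rule sum.neutral, rule ballI)
    fix i assume "i \<in> {..<d}"
    then have "i < card A" using insert.prems insert.hyps by simp
    then show "of_nat (d choose i) * (\<Sum>S\<in>Pow A. (-1) ^ card S * (c - 1 - of_nat (card S)) ^ i) = 0"
      by (simp add: insert.IH)
  qed
  finally show ?case .
qed

section \<open>Trees and their leaves\<close>

text \<open>As a relation the edges admit \<open>rtrancl\<close>, whose inductions are handier than
  walks given as lists.\<close>

definition adj :: "'a set set \<Rightarrow> ('a \<times> 'a) set" where
  "adj E = {(x, y). {x, y} \<in> E}"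

definition is_leaf :: "'a set set \<Rightarrow> 'a \<Rightarrow> bool" where
  "is_leaf E s \<longleftrightarrow> (\<exists>!u. {s, u} \<in> E)"

definition trees_on :: "'a set \<Rightarrow> 'a set set set" where
  "trees_on V = {E. is_tree (V, E)}"

section \<open>Edges, walks and reachability\<close>

lemma simple_graph_edgeD:
  assumes "simple_graph (V, E)" "{x, y} \<in> E"
  shows "x \<in> V" "y \<in> V" "x \<noteq> y"
  using assms by (auto simp: simple_graph_def)

lemma simple_graph_edgeE:
  assumes "simple_graph (V, E)" "e \<in> E"
  obtains x y where "e = {x, y}" "x \<noteq> y" "x \<in> V" "y \<in> V"
  using assms by (fastforce simp: simple_graph_def card_2_iff)

lemma walk_imp_rtrancl:
  assumes "walk (V, E) p"
  shows "(hd p, last p) \<in> (adj E)\<^sup>*"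
  using assms
proof (induction p)
  case Nil
  then show ?case by (simp add: walk_def)
next
  case (Cons x p)
  show ?case
  proof (cases "p = []")
    case False
    then have "(hd p, last p) \<in> (adj E)\<^sup>*" "(x, hd p) \<in> adj E"
      using Cons by (auto simp: walk_def successively_Cons adj_def)
    then show ?thesis using False by (simp add: converse_rtrancl_into_rtrancl)
  qed simp
qed

lemma rtrancl_imp_walk:
  assumes "simple_graph (V, E)" "v \<in> V" "(u, v) \<in> (adj E)\<^sup>*"
  shows "\<exists>p. walk (V, E) p \<and> hd p = u \<and> last p = v"
  using assms(3)
proof (induction rule: converse_rtrancl_induct)
  case base
  show ?case using assms(2) by (intro exI[of _ "[v]"]) (simp add: walk_def)
next
  case (step x y)
  then obtain p where "walk (V, E) p" "hd p = y" "last p = v" by blast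
  then show ?case using step.hyps(1) simple_graph_edgeD[OF assms(1)]
    by (intro exI[of _ "x # p"]) (auto simp: walk_def successively_Cons adj_def)
qed

lemma graph_connected_iff_rtrancl:
  assumes "simple_graph (V, E)"
  shows "graph_connected (V, E) \<longleftrightarrow> V \<noteq> {} \<and> (\<forall>u\<in>V. \<forall>v\<in>V. (u, v) \<in> (adj E)\<^sup>*)"
  unfolding graph_connected_def fst_conv
  using walk_imp_rtrancl rtrancl_imp_walk[OF assms] by metis

text \<open>Predecessor and successor of \<open>x\<close> in the cyclic order differ because a cycle
  has at least three vertices. The purpose is to keep a vertex with a single neighbour off every
  cycle.\<close>

lemma graph_cycle_two_neighbours:
  assumes "graph_cycle (V, E) c" "x \<in> set c"
  shows "\<exists>y z. y \<noteq> z \<and> {x, y} \<in> E \<and> {x, z} \<in> E"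
proof -
  have c: "successively (\<lambda>u v. {u, v} \<in> E) c" "distinct c" "length c \<ge> 3" "{last c, hd c} \<in> E"
    using assms(1) by (auto simp: graph_cycle_def walk_def)
  obtain xs ys where s: "c = xs @ x # ys" using assms(2) by (meson split_list)
  \<comment> \<open>Predecessor and successor, wrapping around through the closing edge when
    \<open>x\<close> is at an end of the list.\<close>
  let ?y = "if xs = [] then last ys else last xs"
  let ?z = "if ys = [] then hd xs else hd ys"
  have "{x, ?y} \<in> E" "{x, ?z} \<in> E"
    using c(1,3,4) unfolding s
    by (auto simp: successively_append_iff successively_Cons insert_commute hd_append split: if_splits)
  moreover have "?y \<noteq> ?z"
  proof (cases "xs = [] \<or> ys = []")
    case True
    \<comment> \<open>If \<open>x\<close> is at an end of \<open>c\<close>, its neighbours are the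
      two ends of the remaining list, which has at least two entries.\<close>
    have *: "last zs \<noteq> hd zs" if "distinct zs" "length zs \<ge> 2" for zs :: "'a list"
      using that by (cases zs) (auto split: if_splits)
    show ?thesis using True c(2,3) *[of xs] *[of ys] unfolding s by auto
  next
    case False
    moreover have "set xs \<inter> set ys = {}" using c(2) unfolding s by auto
    ultimately show ?thesis by (metis disjoint_iff hd_in_set last_in_set)
  qed
  ultimately show ?thesis by blast
qed

text \<open>A cycle through the new vertex would give it two neighbours, and a cycle avoiding it
  already lies in the old tree.\<close>

lemma is_tree_add_leaf:
  assumes T: "is_tree (V, E)" and s: "s \<notin> V" and u: "u \<in> V"
  shows "is_tree (insert s V, insert {s, u} E)"
proof -
  let ?E = "insert {s, u} E"
  have sg: "simple_graph (V, E)" using T by (simp add: is_tree_def)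
  have sg': "simple_graph (insert s V, ?E)"
    using sg s u by (auto simp: simple_graph_def card_2_iff)
  have con: "(x, y) \<in> (adj E)\<^sup>*" if "x \<in> V" "y \<in> V" for x y
    using T that by (auto simp: is_tree_def graph_connected_iff_rtrancl[OF sg])
  have "(adj E)\<^sup>* \<subseteq> (adj ?E)\<^sup>*" by (rule rtrancl_mono) (auto simp: adj_def)
  then have con': "(x, y) \<in> (adj ?E)\<^sup>*" if "x \<in> V" "y \<in> V" for x y
    using con[OF that] by blast
  have "(s, u) \<in> adj ?E" "(u, s) \<in> adj ?E" by (auto simp: adj_def insert_commute)
  then have "(x, y) \<in> (adj ?E)\<^sup>*" if "x \<in> insert s V" "y \<in> insert s V" for x y
    using that con' u
    by (metis insertE converse_rtrancl_into_rtrancl rtrancl.rtrancl_into_rtrancl rtrancl.rtrancl_refl)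
  then have "graph_connected (insert s V, ?E)"
    by (simp add: graph_connected_iff_rtrancl[OF sg'])
  moreover have "\<not> graph_cycle (insert s V, ?E) c" for c
  proof
    assume c: "graph_cycle (insert s V, ?E) c"
    have "s \<notin> set c"
    proof
      assume "s \<in> set c"
      from graph_cycle_two_neighbours[OF c this] show False
        using s simple_graph_edgeD[OF sg] by (auto simp: doubleton_eq_iff)
    qed
    moreover from this have "{last c, hd c} \<in> E"
      using c by (auto simp: graph_cycle_def walk_def doubleton_eq_iff)
    moreover have "successively (\<lambda>u v. {u, v} \<in> E) c"
      by (rule successively_mono[where P = "\<lambda>u v. {u, v} \<in> ?E"])
         (use c \<open>s \<notin> set c\<close> in \<open>auto simp: graph_cycle_def walk_def doubleton_eq_iff\<close>)
    ultimately have "graph_cycle (V, E) c"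
      using c by (auto simp: graph_cycle_def walk_def)
    then show False using T by (auto simp: is_tree_def)
  qed
  ultimately show ?thesis using sg' by (auto simp: is_tree_def)
qed

text \<open>A connection passing through the leaf enters and leaves it by \<open>u\<close>, so the
  visit can be cut out.\<close>

lemma is_tree_remove_leaf:
  assumes T: "is_tree (V, E)" and leaf: "is_leaf E s" and su: "{s, u} \<in> E"
  shows "is_tree (V - {s}, E - {{s, u}})"
proof -
  let ?E = "E - {{s, u}}"
  have sg: "simple_graph (V, E)" using T by (simp add: is_tree_def)
  have nb: "y = u" if "{s, y} \<in> E" for y
    using leaf su that by (auto simp: is_leaf_def)
  have notin: "s \<notin> e" if "e \<in> ?E" for e
  proof
    assume "s \<in> e"
    from that obtain x y where "e = {x, y}" using simple_graph_edgeE[OF sg] by blast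
    with \<open>s \<in> e\<close> obtain y where "e = {s, y}" by (auto simp: insert_commute)
    with nb that show False by auto
  qed
  have sg': "simple_graph (V - {s}, ?E)"
    using sg notin by (fastforce simp: simple_graph_def)
  \<comment> \<open>Invariant along a connection in \<open>E\<close>: while it sits at
    \<open>s\<close>, the connection built in \<open>?E\<close> waits at \<open>u\<close>, the only
    neighbour of \<open>s\<close>.\<close>
  have "if y = s then (x, u) \<in> (adj ?E)\<^sup>* else (x, y) \<in> (adj ?E)\<^sup>*"
    if "(x, y) \<in> (adj E)\<^sup>*" "x \<noteq> s" for x y
    using that(1)
  proof (induction rule: rtrancl_induct)
    case base
    then show ?case using that(2) by simp
  next
    case (step y z)
    have "{y, z} \<in> E" using step.hyps(2) by (simp add: adj_def)
    consider "y = s" "z = u" "z \<noteq> s" | "z = s" "y = u" "y \<noteq> s" | "(y, z) \<in> adj ?E" "y \<noteq> s" "z \<noteq> s"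
    proof -
      have yz: "y \<noteq> z" using simple_graph_edgeD[OF sg \<open>{y, z} \<in> E\<close>] by blast
      have zy: "{z, y} \<in> E" using \<open>{y, z} \<in> E\<close> by (simp add: insert_commute)
      consider "y = s" | "z = s" | "y \<noteq> s" "z \<noteq> s" by blast
      then show thesis
      proof cases
        case 1
        then show thesis using that(1) nb[of z] \<open>{y, z} \<in> E\<close> yz by blast
      next
        case 2
        then show thesis using that(2) nb[of y] zy yz by blast
      next
        case 3
        then have "{y, z} \<noteq> {s, u}" by (auto simp: doubleton_eq_iff)
        then show thesis using that(3) 3 \<open>{y, z} \<in> E\<close> by (simp add: adj_def)
      qed
    qed
    then show ?case
      using step.IH by cases (auto intro: rtrancl_into_rtrancl)
  qed
  moreover have "(x, y) \<in> (adj E)\<^sup>*" if "x \<in> V" "y \<in> V" for x y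
    using T that by (auto simp: is_tree_def graph_connected_iff_rtrancl[OF sg])
  ultimately have "(x, y) \<in> (adj ?E)\<^sup>*" if "x \<in> V - {s}" "y \<in> V - {s}" for x y
    using that by (metis Diff_iff singletonI)
  moreover have "u \<in> V - {s}" using simple_graph_edgeD[OF sg su] by auto
  ultimately have "graph_connected (V - {s}, ?E)"
    unfolding graph_connected_iff_rtrancl[OF sg'] by blast
  moreover have "\<not> graph_cycle (V - {s}, ?E) c" for c
  proof
    assume c: "graph_cycle (V - {s}, ?E) c"
    have "successively (\<lambda>u v. {u, v} \<in> E) c"
      by (rule successively_mono[where P = "\<lambda>u v. {u, v} \<in> ?E"])
         (use c in \<open>auto simp: graph_cycle_def walk_def\<close>)
    then have "graph_cycle (V, E) c"
      using c by (auto simp: graph_cycle_def walk_def)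
    then show False using T by (auto simp: is_tree_def)
  qed
  ultimately show ?thesis using sg' by (auto simp: is_tree_def)
qed

text \<open>The far end of a longest path starting at \<open>r\<close> is a leaf.\<close>

lemma is_tree_exists_leaf:
  assumes T: "is_tree (V, E)" and fin: "finite V" and r: "r \<in> V" and V: "V \<noteq> {r}"
  shows "\<exists>s\<in>V - {r}. is_leaf E s"
proof -
  have sg: "simple_graph (V, E)" using T by (simp add: is_tree_def)
  \<comment> \<open>Paths are stored backwards, from the far end to \<open>r\<close>, so that
    extending one is a \<open>Cons\<close>.\<close>
  define P where "P p \<longleftrightarrow> walk (V, E) p \<and> distinct p \<and> last p = r" for p
  have "P [r]" using r by (simp add: P_def walk_def)
  \<comment> \<open>Vertices do not repeat, so lengths are bounded and a longest path
    exists.\<close>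
  moreover have "length p < Suc (card V)" if "P p" for p
    using that fin by (metis P_def walk_def card_mono distinct_card fst_conv less_Suc_eq_le)
  ultimately obtain p where p: "P p" and max: "\<And>q. P q \<Longrightarrow> length q \<le> length p"
    using ex_has_greatest_nat[of P "[r]" length "Suc (card V)"] by auto
  obtain w where w: "w \<in> V" "w \<noteq> r" using V r by blast
  have "(r, w) \<in> (adj E)\<^sup>*"
    using T w r by (auto simp: is_tree_def graph_connected_iff_rtrancl[OF sg])
  with w obtain y where "{r, y} \<in> E" by (auto simp: adj_def elim: converse_rtranclE)
  \<comment> \<open>A path with two vertices exists, so the longest one has a far end
    \<open>x\<close> other than \<open>r\<close>, and a next vertex \<open>y\<close>.\<close>
  then have "P [y, r]" using simple_graph_edgeD[OF sg, of r y]
    by (auto simp: P_def walk_def insert_commute)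
  from max[OF this] obtain x y q where pq: "p = x # y # q"
    by (cases p; cases "tl p") auto
  have xy: "{x, y} \<in> E" using p by (simp add: P_def walk_def pq)
  \<comment> \<open>A second neighbour \<open>z\<close> of \<open>x\<close> would lengthen the path
    if it lies off it, and close a cycle if it lies on it.\<close>
  have "z = y" if z: "{x, z} \<in> E" for z
  proof (rule ccontr)
    assume "z \<noteq> y"
    have zV: "z \<in> V" "z \<noteq> x" using simple_graph_edgeD[OF sg z] by auto
    show False
    proof (cases "z \<in> set p")
      case False
      then have "P (z # p)"
        using p z zV by (auto simp: P_def walk_def successively_Cons pq insert_commute)
      from max[OF this] show False by simp
    next
      case True
      with \<open>z \<noteq> y\<close> zV(2) obtain q1 q2 where q: "q = q1 @ z # q2"
        unfolding pq by (metis set_ConsD split_list)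
      have "graph_cycle (V, E) (x # y # q1 @ [z])"
        using p z unfolding P_def pq q graph_cycle_def walk_def
        by (auto simp: successively_append_iff successively_Cons insert_commute hd_append)
      then show False using T by (auto simp: is_tree_def)
    qed
  qed
  then have "is_leaf E x" using xy by (auto simp: is_leaf_def)
  moreover have "x \<noteq> r" "x \<in> V"
    using p by (auto simp: P_def walk_def pq split: if_splits)
  ultimately show ?thesis by blast
qed

section \<open>Small trees and the number of edges\<close>

lemma is_tree_simple_graph: "is_tree T \<Longrightarrow> simple_graph T"
  by (simp add: is_tree_def)

lemma is_tree_singleton_iff: "is_tree ({r}, E) \<longleftrightarrow> E = {}"
proof
  assume "is_tree ({r}, E)"
  then show "E = {}"
    using is_tree_simple_graph simple_graph_edgeE[of "{r}" E] by blast
next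
  assume E: "E = {}"
  have "simple_graph ({r}, E)" by (simp add: simple_graph_def E)
  then have "graph_connected ({r}, E)" by (simp add: graph_connected_iff_rtrancl)
  then show "is_tree ({r}, E)"
    using \<open>simple_graph ({r}, E)\<close> by (auto simp: is_tree_def graph_cycle_def E)
qed

lemma is_tree_nonempty: "is_tree (V, E) \<Longrightarrow> V \<noteq> {}"
  by (simp add: is_tree_def graph_connected_def)

lemma is_tree_finite_edges: "is_tree (V, E) \<Longrightarrow> finite V \<Longrightarrow> finite E"
  by (rule finite_subset[of _ "Pow V"]) (auto simp: is_tree_def simple_graph_def)

text \<open>Deleting a leaf removes exactly one vertex and one edge, until a single vertex is
  left.\<close>

lemma card_edges_is_tree:
  assumes "is_tree (V, E)" "finite V"
  shows "card E = card V - 1"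
  using assms(2,1)
proof (induction V arbitrary: E rule: finite_psubset_induct)
  case (psubset V)
  obtain r where r: "r \<in> V" using is_tree_nonempty[OF psubset.prems] by blast
  show ?case
  proof (cases "V = {r}")
    case True
    then show ?thesis using psubset.prems by (simp add: is_tree_singleton_iff)
  next
    case False
    then obtain s where s: "s \<in> V" "s \<noteq> r" "is_leaf E s"
      using is_tree_exists_leaf[OF psubset.prems psubset.hyps r] by blast
    then obtain u where u: "{s, u} \<in> E" by (auto simp: is_leaf_def)
    have "card (E - {{s, u}}) = card (V - {s}) - 1"
      using is_tree_remove_leaf[OF psubset.prems s(3) u] s(1) by (intro psubset.IH) auto
    \<comment> \<open>These two bounds make the truncated subtractions exact.\<close>
    moreover have "card V \<ge> 2"
      using card_mono[OF psubset.hyps, of "{r, s}"] r s by simp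
    moreover have "card E > 0"
      using u is_tree_finite_edges[OF psubset.prems psubset.hyps] by (auto simp: card_gt_0_iff)
    ultimately show ?thesis
      using u s is_tree_finite_edges[OF psubset.prems psubset.hyps] psubset.hyps by simp
  qed
qed

lemma finite_trees_on: "finite V \<Longrightarrow> finite (trees_on V)"
  by (rule finite_subset[of _ "Pow (Pow V)"])
     (auto simp: trees_on_def is_tree_def simple_graph_def)

section \<open>Cayley's formula\<close>

text \<open>\<open>S\<close> prescribes some leaves; vertices outside \<open>S\<close> may be leaves
  too, as inclusion-exclusion requires.\<close>

definition leafy_trees :: "'a set \<Rightarrow> 'a set \<Rightarrow> 'a set set set" where
  "leafy_trees V S = {E \<in> trees_on V. \<forall>x\<in>S. is_leaf E x}"

text \<open>The vertex \<open>r\<close> outside \<open>S\<close> ensures that two leaves in \<open>insert s S\<close> are never adjacent: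
  otherwise they would form a connected component of their own.\<close>

lemma leaves_not_adjacent:
  assumes T: "is_tree (V, E)" and "is_leaf E s" "is_leaf E x" and r: "r \<in> V" "r \<noteq> s" "r \<noteq> x"
  shows "{s, x} \<notin> E"
proof
  assume sx: "{s, x} \<in> E"
  have sg: "simple_graph (V, E)" using T by (simp add: is_tree_def)
  have nb: "y = x" if "{s, y} \<in> E" for y using assms(2) sx that by (auto simp: is_leaf_def)
  have nb': "y = s" if "{x, y} \<in> E" for y
    using assms(3) sx that by (auto simp: is_leaf_def insert_commute)
  have "y \<in> {s, x}" if "(s, y) \<in> (adj E)\<^sup>*" for y
    using that by (induction rule: rtrancl_induct) (auto simp: adj_def dest: nb nb')
  moreover have "(s, r) \<in> (adj E)\<^sup>*"
    using T r simple_graph_edgeD[OF sg sx]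
    by (auto simp: is_tree_def graph_connected_iff_rtrancl[OF sg])
  ultimately show False using r by blast
qed

text \<open>A tree with the further leaf \<open>s\<close> is a tree without \<open>s\<close> plus
  the choice of the neighbour \<open>u\<close>. A neighbour in \<open>S\<close> would cease to be a
  leaf, so \<open>u\<close> ranges outside \<open>S\<close>. The inverse deletes the edge at
  \<open>s\<close>.\<close>

lemma bij_betw_add_leaf:
  assumes s: "s \<in> V" "s \<notin> S" and r: "r \<in> V" "r \<notin> S" "r \<noteq> s"
  shows "bij_betw (\<lambda>(E, u). insert {s, u} E)
           (leafy_trees (V - {s}) S \<times> (V - {s} - S)) (leafy_trees V (insert s S))"
proof (rule bij_betwI[where g = "\<lambda>E. (E - {{s, THE u. {s, u} \<in> E}}, THE u. {s, u} \<in> E)"])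
  have no_s: "{s, y} \<notin> E" "{y, s} \<notin> E" if "E \<in> leafy_trees (V - {s}) S" for E y
    using that by (auto simp: leafy_trees_def trees_on_def is_tree_def dest: simple_graph_edgeD)
  show "(\<lambda>(E, u). insert {s, u} E) \<in> leafy_trees (V - {s}) S \<times> (V - {s} - S) \<rightarrow> leafy_trees V (insert s S)"
  proof (rule funcsetI)
    fix p assume "p \<in> leafy_trees (V - {s}) S \<times> (V - {s} - S)"
    then obtain E u where p: "p = (E, u)" and E: "E \<in> leafy_trees (V - {s}) S"
      and u: "u \<in> V" "u \<notin> S" "u \<noteq> s" by auto
    have "is_tree (insert s (V - {s}), insert {s, u} E)"
      using E u by (intro is_tree_add_leaf) (auto simp: leafy_trees_def trees_on_def)
    then have "insert {s, u} E \<in> trees_on V"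
      using s by (simp add: trees_on_def insert_absorb)
    moreover have "is_leaf (insert {s, u} E) s"
      using no_s[OF E] by (auto simp: is_leaf_def doubleton_eq_iff)
    moreover have "is_leaf (insert {s, u} E) x" if "x \<in> S" for x
    proof -
      have "is_leaf E x" using E that by (simp add: leafy_trees_def)
      moreover have "{x, y} \<noteq> {s, u}" for y
        using that s u by (auto simp: doubleton_eq_iff)
      ultimately show ?thesis by (simp add: is_leaf_def)
    qed
    ultimately show "(case p of (E, u) \<Rightarrow> insert {s, u} E) \<in> leafy_trees V (insert s S)"
      by (auto simp: leafy_trees_def p)
  qed
  have the: "(THE u. {s, u} \<in> E) = u" if "is_leaf E s" "{s, u} \<in> E" for E u
    using that by (auto simp: is_leaf_def)
  show "(\<lambda>E. (E - {{s, THE u. {s, u} \<in> E}}, THE u. {s, u} \<in> E))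
        \<in> leafy_trees V (insert s S) \<rightarrow> leafy_trees (V - {s}) S \<times> (V - {s} - S)"
  proof
    fix E assume E: "E \<in> leafy_trees V (insert s S)"
    then have T: "is_tree (V, E)" and leaf: "is_leaf E s" "\<And>x. x \<in> S \<Longrightarrow> is_leaf E x"
      by (auto simp: leafy_trees_def trees_on_def)
    obtain u where u: "{s, u} \<in> E" using leaf(1) by (auto simp: is_leaf_def)
    have uV: "u \<in> V" "u \<noteq> s" using simple_graph_edgeD[OF is_tree_simple_graph[OF T] u] by auto
    \<comment> \<open>Otherwise \<open>s\<close> and \<open>u\<close> would be adjacent leaves, cut
      off from \<open>r\<close>. Hence deleting the edge leaves all edges at \<open>S\<close>
      untouched.\<close>
    have uS: "u \<notin> S" using leaves_not_adjacent[OF T leaf(1) leaf(2) r(1)] r u by auto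
    have "is_leaf (E - {{s, u}}) x" if "x \<in> S" for x
    proof -
      have "{x, y} \<noteq> {s, u}" for y
        using that s uS by (auto simp: doubleton_eq_iff)
      then show ?thesis using leaf(2)[OF that] by (simp add: is_leaf_def)
    qed
    then have "E - {{s, u}} \<in> leafy_trees (V - {s}) S"
      using is_tree_remove_leaf[OF T leaf(1) u] by (simp add: leafy_trees_def trees_on_def)
    then show "(E - {{s, THE u. {s, u} \<in> E}}, THE u. {s, u} \<in> E)
        \<in> leafy_trees (V - {s}) S \<times> (V - {s} - S)"
      using uV uS by (simp add: the[OF leaf(1) u])
  qed
  show "(\<lambda>E. (E - {{s, THE u. {s, u} \<in> E}}, THE u. {s, u} \<in> E)) ((\<lambda>(E, u). insert {s, u} E) p) = p"
    if "p \<in> leafy_trees (V - {s}) S \<times> (V - {s} - S)" for p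
  proof -
    from that obtain E u where p: "p = (E, u)" "E \<in> leafy_trees (V - {s}) S" by auto
    have "is_leaf (insert {s, u} E) s"
      using no_s[OF p(2)] by (auto simp: is_leaf_def doubleton_eq_iff)
    from the[OF this, of u] show ?thesis using no_s[OF p(2)] p by auto
  qed
  show "(\<lambda>(E, u). insert {s, u} E) (E - {{s, THE u. {s, u} \<in> E}}, THE u. {s, u} \<in> E) = E"
    if "E \<in> leafy_trees V (insert s S)" for E
  proof -
    have leaf: "is_leaf E s" using that by (auto simp: leafy_trees_def)
    then obtain u where u: "{s, u} \<in> E" by (auto simp: is_leaf_def)
    then show ?thesis by (auto simp: the[OF leaf u])
  qed
qed

text \<open>Leaves are stripped one at a time by the bijection. Removing \<open>s\<close> from both
  \<open>V\<close> and the leaf set keeps the number of attachment vertices equal to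
  \<open>card V - card S\<close>, so all factors coincide.\<close>

lemma card_leafy_trees:
  assumes "finite V" "S \<subseteq> V" "r \<in> V" "r \<notin> S"
  shows "card (leafy_trees V S) = (card V - card S) ^ card S * card (trees_on (V - S))"
proof -
  have "finite S" using assms finite_subset by blast
  then show ?thesis using assms
  proof (induction S arbitrary: V)
    case empty
    then show ?case by (simp add: leafy_trees_def)
  next
    case (insert s S)
    have "card (leafy_trees V (insert s S)) = card (leafy_trees (V - {s}) S \<times> (V - {s} - S))"
      using bij_betw_same_card[OF bij_betw_add_leaf[of s V S r]] insert by auto
    also have "\<dots> = card (leafy_trees (V - {s}) S) * (card V - card (insert s S))"
      using insert.prems insert.hyps
      by (simp add: card_cartesian_product card_Diff_subset subset_Diff_insert)
    also have "card (leafy_trees (V - {s}) S)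
        = (card (V - {s}) - card S) ^ card S * card (trees_on (V - {s} - S))"
      using insert by (intro insert.IH) auto
    finally show ?case
      using insert.prems insert.hyps by (simp add: Diff_insert2[symmetric] ac_simps)
  qed
qed

text \<open>After exchanging the sums, each tree contributes the alternating sum over all subsets of
  its leaves other than \<open>r\<close>; this leaf set is nonempty, so the contribution is
  zero.\<close>

lemma alternating_sum_leafy_trees:
  assumes V: "finite V" "r \<in> V" "V \<noteq> {r}"
  shows "(\<Sum>S\<in>Pow (V - {r}). (-1) ^ card S * int (card (leafy_trees V S))) = 0"
proof -
  let ?A = "Pow (V - {r})"
  have "(\<Sum>S\<in>?A. (-1) ^ card S * int (card (leafy_trees V S)))
      = (\<Sum>S\<in>?A. \<Sum>E\<in>trees_on V. if \<forall>x\<in>S. is_leaf E x then (-1) ^ card S else 0)"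
    using finite_trees_on[OF V(1)]
    by (intro sum.cong refl) (simp add: leafy_trees_def sum.If_cases Int_def)
  also have "\<dots> = (\<Sum>E\<in>trees_on V. \<Sum>S\<in>?A. if \<forall>x\<in>S. is_leaf E x then (-1) ^ card S else 0)"
    by (rule sum.swap)
  also have "\<dots> = 0"
  proof (rule sum.neutral, rule ballI)
    fix E assume "E \<in> trees_on V"
    then obtain s where s: "s \<in> V - {r}" "is_leaf E s"
      using is_tree_exists_leaf[of V E r] V by (auto simp: trees_on_def)
    let ?L = "{x \<in> V - {r}. is_leaf E x}"
    have L: "finite ?L" "card ?L > 0" using s V by (auto simp: card_gt_0_iff)
    have "(\<Sum>S\<in>?A. if \<forall>x\<in>S. is_leaf E x then (-1) ^ card S else 0) = (\<Sum>S\<in>Pow ?L. (-1) ^ card S :: int)"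
      using V by (intro sum.mono_neutral_cong_right) auto
    \<comment> \<open>The finite-difference lemma in degree 0.\<close>
    also have "\<dots> = 0" using alternating_sum_Pow_power[OF L, of "0 :: int"] by simp
    finally show "(\<Sum>S\<in>?A. if \<forall>x\<in>S. is_leaf E x then (-1) ^ card S else 0) = (0 :: int)" .
  qed
  finally show ?thesis .
qed

theorem cayley_formula:
  fixes V :: "'a set"
  assumes "finite V" "V \<noteq> {}"
  shows "card (trees_on V) = card V ^ (card V - 2)"
  using assms
proof (induction V rule: finite_psubset_induct)
  case (psubset V)
  obtain r where r: "r \<in> V" using psubset.prems by blast
  show ?case
  proof (cases "V = {r}")
    case True
    \<comment> \<open>The truncated exponent is harmless here, as the base is 1.\<close>
    then show ?thesis by (simp add: trees_on_def is_tree_singleton_iff)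
  next
    case False
    let ?A = "Pow (V - {r})"
    let ?f = "\<lambda>S. (-1) ^ card S * int (card (leafy_trees V S))"
    let ?g = "\<lambda>S :: 'a set. (-1) ^ card S * (int (card V) - int (card S)) ^ (card V - 2)"
    obtain v where v: "v \<in> V" "v \<noteq> r" using r False by blast
    then have n: "card V \<ge> 2" using card_mono[OF psubset.hyps, of "{r, v}"] r by simp
    have "?f S = ?g S" if S: "S \<in> ?A - {{}}" for S
    proof -
      have S': "finite S" "S \<noteq> {}" "S \<subseteq> V" "r \<notin> S"
        using S psubset.hyps finite_subset by auto
      have le: "card S < card V" using S' r psubset.hyps by (intro psubset_card_mono) auto
      have "card (trees_on (V - S)) = (card V - card S) ^ (card V - card S - 2)"
        using psubset.IH[of "V - S"] S' r psubset.hyps by (auto simp: card_Diff_subset)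
      then have "card (leafy_trees V S) = (card V - card S) ^ (card S + (card V - card S - 2))"
        using card_leafy_trees[OF psubset.hyps S'(3) r S'(4)] by (simp add: power_add)
      \<comment> \<open>If only \<open>r\<close> remains, truncation makes the exponent one too
        large, but then the base is 1.\<close>
      also have "\<dots> = (card V - card S) ^ (card V - 2)"
      proof (cases "card V - card S = 1")
        case False
        then have "card S + (card V - card S - 2) = card V - 2" using le by linarith
        then show ?thesis by simp
      qed simp
      finally show ?thesis using le by (simp add: of_nat_diff)
    qed
    then have "sum ?f (?A - {{}}) = sum ?g (?A - {{}})" by (intro sum.cong) auto
    moreover have "sum ?f ?A = 0"
      using alternating_sum_leafy_trees[OF psubset.hyps r False] .
    \<comment> \<open>The degree \<open>card V - 2\<close> is just below the number
      \<open>card V - 1\<close> of elements of \<open>V - {r}\<close>.\<close>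
    moreover have "sum ?g ?A = 0"
      using n r psubset.hyps by (intro alternating_sum_Pow_power) auto
    moreover have "sum ?f ?A = ?f {} + sum ?f (?A - {{}})"
      using psubset.hyps by (intro sum.remove) auto
    moreover have "sum ?g ?A = ?g {} + sum ?g (?A - {{}})"
      using psubset.hyps by (intro sum.remove) auto
    ultimately have "?f {} = ?g {}" by linarith
    then have "int (card (trees_on V)) = int (card V ^ (card V - 2))"
      by (simp add: leafy_trees_def)
    then show ?thesis by (simp only: of_nat_eq_iff)
  qed
qed

section \<open>Asymptotics\<close>

text \<open>The number of subtrees of the complete graph with \<open>n - j\<close> vertices, divided by
  the number of spanning trees.\<close>

definition subtree_ratio :: "nat \<Rightarrow> nat \<Rightarrow> real" where
  "subtree_ratio j n = (if j + 2 \<le> n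
     then real (n choose j) * real (n - j) ^ (n - j - 2) / real n ^ (n - 2) else 0)"

text \<open>Up to the factor \<open>fact j\<close>, the quotient is a product of the fixed number
  \<open>j\<close> of factors \<open>1 - i / n\<close>, each tending to 1.\<close>

lemma binomial_div_power_tendsto:
  "(\<lambda>n. real (n choose j) / real n ^ j) \<longlonglongrightarrow> 1 / fact j"
proof (rule Lim_transform_eventually)
  have "(\<lambda>n. 1 - real i / real n) \<longlonglongrightarrow> 1 - 0" for i
    by (intro tendsto_diff tendsto_const lim_const_over_n)
  then have "(\<lambda>n. \<Prod>i<j. 1 - real i / real n) \<longlonglongrightarrow> (\<Prod>i<j. 1 - 0)"
    by (intro tendsto_prod)
  then show "(\<lambda>n. (\<Prod>i<j. 1 - real i / real n) / fact j) \<longlonglongrightarrow> 1 / fact j"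
    by (intro tendsto_divide tendsto_const) auto
  show "\<forall>\<^sub>F n in sequentially. (\<Prod>i<j. 1 - real i / real n) / fact j = real (n choose j) / real n ^ j"
    using eventually_gt_at_top[of 0]
  proof eventually_elim
    case (elim n)
    have "real (n choose j) / real n ^ j = (\<Prod>i<j. real n - real i) / (\<Prod>i<j. real n) / fact j"
      by (simp add: binomial_gbinomial gbinomial_prod_rev atLeast0LessThan)
    also have "\<dots> = (\<Prod>i<j. 1 - real i / real n) / fact j"
      unfolding prod_dividef[symmetric] using elim by (simp add: diff_divide_distrib)
    finally show ?case by simp
  qed
qed

text \<open>In this form the only exponent that grows with \<open>n\<close> is in
  \<open>(1 - j / n) ^ n\<close>, whose limit is exponential.\<close>

lemma subtree_ratio_eq:
  assumes "j + 2 \<le> n"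
  shows "subtree_ratio j n
    = real (n choose j) / real n ^ j * (1 - real j / real n) ^ n / (1 - real j / real n) ^ (j + 2)"
proof -
  have x: "1 - real j / real n = real (n - j) / real n" "real (n - j) / real n \<noteq> 0"
    using assms by (auto simp: field_simps)
  have "(real (n - j) / real n) ^ n / (real (n - j) / real n) ^ (j + 2) = (real (n - j) / real n) ^ (n - j - 2)"
    using assms power_diff[OF x(2), of "j + 2" n] by (simp del: power_add)
  moreover have "real n ^ (n - 2) = real n ^ j * real n ^ (n - j - 2)"
    using assms by (simp flip: power_add)
  ultimately show ?thesis
    unfolding x(1) times_divide_eq_right[symmetric]
    using assms by (simp add: subtree_ratio_def power_divide)
qed

lemma subtree_ratio_tendsto: "subtree_ratio j \<longlonglongrightarrow> exp (-1) ^ j / fact j"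
proof (rule Lim_transform_eventually)
  have "(\<lambda>n. 1 - real j / real n) \<longlonglongrightarrow> 1 - 0"
    by (intro tendsto_diff tendsto_const lim_const_over_n)
  then have "(\<lambda>n. (1 - real j / real n) ^ (j + 2)) \<longlonglongrightarrow> (1 - 0) ^ (j + 2)"
    by (rule tendsto_power)
  moreover have "(\<lambda>n. (1 - real j / real n) ^ n) \<longlonglongrightarrow> exp (- real j)"
    using tendsto_exp_limit_sequentially[of "- real j"] by simp
  ultimately have "(\<lambda>n. real (n choose j) / real n ^ j * (1 - real j / real n) ^ n / (1 - real j / real n) ^ (j + 2))
      \<longlonglongrightarrow> 1 / fact j * exp (- real j) / (1 - 0) ^ (j + 2)"
    by (intro tendsto_mult tendsto_divide binomial_div_power_tendsto) auto
  also have "1 / fact j * exp (- real j) / (1 - 0) ^ (j + 2) = exp (-1) ^ j / fact j"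
    by (simp add: exp_of_nat_mult[symmetric])
  finally show "(\<lambda>n. real (n choose j) / real n ^ j * (1 - real j / real n) ^ n / (1 - real j / real n) ^ (j + 2))
      \<longlonglongrightarrow> exp (-1) ^ j / fact j" .
  show "\<forall>\<^sub>F n in sequentially. real (n choose j) / real n ^ j * (1 - real j / real n) ^ n / (1 - real j / real n) ^ (j + 2)
      = subtree_ratio j n"
    using eventually_ge_at_top[of "j + 2"] by eventually_elim (simp only: subtree_ratio_eq)
qed

lemma subtree_ratio_nonneg: "0 \<le> subtree_ratio j n"
  by (simp add: subtree_ratio_def)

text \<open>Supplies the summable majorant, uniform in \<open>n\<close>, for Tannery's
  theorem.\<close>

lemma subtree_ratio_le: "subtree_ratio j n \<le> 1 / fact j"
proof (cases "j + 2 \<le> n")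
  case True
  have "subtree_ratio j n = (real (n choose j) / real n ^ j) * (real (n - j) / real n) ^ (n - j - 2)"
  proof -
    have "real n ^ (n - 2) = real n ^ j * real n ^ (n - j - 2)"
      using True by (simp flip: power_add)
    then show ?thesis using True by (simp add: subtree_ratio_def power_divide)
  qed
  also have "\<dots> \<le> 1 / fact j * 1"
  proof (rule mult_mono)
    have "real ((n choose j) * fact j) \<le> real (n ^ j)"
      using binomial_fact_pow[of n j] by (simp only: of_nat_le_iff)
    then show "real (n choose j) / real n ^ j \<le> 1 / fact j"
      using True by (simp add: field_simps)
    show "(real (n - j) / real n) ^ (n - j - 2) \<le> 1"
      by (rule power_le_one) (auto simp: divide_le_eq)
  qed auto
  finally show ?thesis by simp
qed (simp add: subtree_ratio_def)

text \<open>The weights \<open>w\<close> let one passage to the limit serve both probabilities; the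
  limiting series is the exponential series at \<open>exp (-1)\<close>.\<close>

lemma sum_subtree_ratio_tendsto:
  assumes "\<And>j. (\<lambda>n. w j n) \<longlonglongrightarrow> 1" "\<And>j n. \<bar>w j n\<bar> \<le> 1"
  shows "(\<lambda>n. \<Sum>j\<le>n. w j n * subtree_ratio j n) \<longlonglongrightarrow> exp (exp (-1))"
proof -
  have "(\<lambda>n. w j n * subtree_ratio j n) \<longlonglongrightarrow> 1 * (exp (-1) ^ j / fact j)" for j
    by (intro tendsto_mult assms subtree_ratio_tendsto)
  moreover have "norm (w j n * subtree_ratio j n) \<le> 1 / fact j" for j n
    using mult_mono[OF assms(2)[of j n] subtree_ratio_le[of j n]] subtree_ratio_nonneg[of j n]
    by (simp add: abs_mult)
  moreover have "summable (\<lambda>j. 1 / fact j :: real)"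
    using summable_exp[of "1 :: real"] by (simp add: field_simps)
  ultimately have "(\<lambda>n. \<Sum>j. w j n * subtree_ratio j n) \<longlonglongrightarrow> (\<Sum>j. 1 * (exp (-1) ^ j / fact j))"
    using tannerys_theorem[where a = "\<lambda>j n. w j n * subtree_ratio j n" and M = "\<lambda>j. 1 / fact j"
        and b = "\<lambda>j. 1 * (exp (-1) ^ j / fact j)" and F = sequentially]
    by (simp add: case_prod_unfold)
  also have "(\<Sum>j. 1 * (exp (-1) ^ j / fact j)) = exp (exp (-1 :: real))"
    using sums_unique[OF exp_converges[of "exp (-1 :: real)"]]
    by (simp add: divide_inverse mult.commute)
  \<comment> \<open>The ratio is 0 for \<open>j > n\<close>, so the series is a finite sum.\<close>
  also have "(\<lambda>n. \<Sum>j. w j n * subtree_ratio j n) = (\<lambda>n. \<Sum>j\<le>n. w j n * subtree_ratio j n)"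
    by (intro ext suminf_finite) (auto simp: subtree_ratio_def)
  finally show ?thesis .
qed

text \<open>Taylor polynomials enclose \<open>exp (-1)\<close>, and then \<open>exp\<close> at the
  negated ends of that enclosure; monotonicity does the rest. The tolerance is half a unit in the
  sixth decimal.\<close>

lemma exp_minus_exp_approx: "\<bar>exp (- exp (-1)) - (0.692201 :: real)\<bar> < 0.0000005"
proof -
  have taylor: "\<bar>exp x - (\<Sum>m<n. x ^ m / fact m)\<bar> \<le> 3 / fact n" if "\<bar>x\<bar> \<le> 1" for x :: real and n
  proof -
    obtain t where t: "\<bar>t\<bar> \<le> \<bar>x\<bar>" "exp x = (\<Sum>m<n. x ^ m / fact m) + exp t / fact n * x ^ n"
      using Maclaurin_exp_le by blast
    have "exp t \<le> exp 1" using t(1) that by simp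
    then have "exp t \<le> 3" using exp_le by linarith
    moreover have "\<bar>x\<bar> ^ n \<le> 1" using that by (simp add: power_le_one)
    ultimately have "exp t * \<bar>x\<bar> ^ n \<le> 3 * 1" by (intro mult_mono) auto
    then show ?thesis unfolding t(2) by (simp add: abs_mult power_abs divide_right_mono)
  qed
  \<comment> \<open>With twelve terms the error is at most \<open>3 / fact 12\<close>, less than a
    tenth of the width of this enclosure.\<close>
  have 1: "0.3678794 \<le> exp (-1 :: real)" "exp (-1 :: real) \<le> 0.3678795"
    using taylor[of "-1" 12, unfolded abs_le_iff]
    by (auto simp: fact_numeral lessThan_nat_numeral lessThan_Suc power_divide)
  have "exp (-0.3678795) \<le> exp (- exp (-1) :: real)" "exp (- exp (-1) :: real) \<le> exp (-0.3678794)"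
    using 1 by simp_all
  moreover have "0.6922005 < exp (-0.3678795 :: real)"
    using taylor[of "-0.3678795" 12, unfolded abs_le_iff]
    by (auto simp: fact_numeral lessThan_nat_numeral lessThan_Suc power_divide)
  moreover have "exp (-0.3678794 :: real) < 0.6922015"
    using taylor[of "-0.3678794" 12, unfolded abs_le_iff]
    by (auto simp: fact_numeral lessThan_nat_numeral lessThan_Suc power_divide)
  ultimately have "0.6922005 < exp (- exp (-1) :: real)" "exp (- exp (-1) :: real) < 0.6922015"
    by (blast intro: less_le_trans le_less_trans)+
  then show ?thesis unfolding abs_less_iff by simp
qed

section \<open>Subtrees of complete graphs\<close>

text \<open>Every simple graph on a subset of the vertices is a subgraph of the complete graph, and
  by the edge count a tree has an edge iff it has two vertices.\<close>

lemma subtrees_complete_graph_eq: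
  "subtrees (complete_graph n) = (SIGMA V:{V. V \<subseteq> {1..n} \<and> 2 \<le> card V}. trees_on V)"
proof (intro equalityI subsetI)
  fix T assume T: "T \<in> subtrees (complete_graph n)"
  obtain V E where VE: "T = (V, E)" by fastforce
  have V: "V \<subseteq> {1..n}" "is_tree (V, E)" "card E \<ge> 1"
    using T by (auto simp: VE subtrees_def subgraph_def complete_graph_def)
  moreover have "finite V" using V(1) finite_subset by blast
  ultimately have "card V \<ge> 2" using card_edges_is_tree[of V E] by simp
  with V show "T \<in> (SIGMA V:{V. V \<subseteq> {1..n} \<and> 2 \<le> card V}. trees_on V)"
    by (simp add: VE trees_on_def)
next
  fix T assume T: "T \<in> (SIGMA V:{V. V \<subseteq> {1..n} \<and> 2 \<le> card V}. trees_on V)"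
  obtain V E where VE: "T = (V, E)" by fastforce
  have V: "V \<subseteq> {1..n}" "is_tree (V, E)" "card V \<ge> 2"
    using T by (auto simp: VE trees_on_def)
  moreover have "finite V" using V(1) finite_subset by blast
  ultimately have "card E \<ge> 1" using card_edges_is_tree[of V E] by simp
  moreover have "simple_graph (V, E)" using V(2) by (rule is_tree_simple_graph)
  ultimately show "T \<in> subtrees (complete_graph n)"
    using V by (auto simp: VE subtrees_def subgraph_def complete_graph_def simple_graph_def)
qed

lemma spanning_trees_complete_graph_eq:
  "spanning_trees (complete_graph n) = {{1..n}} \<times> trees_on {1..n}"
proof -
  have "simple_graph T" if "is_tree T" for T :: "nat ugraph"
    using that by (rule is_tree_simple_graph)
  then show ?thesis
    by (force simp: spanning_trees_def subgraph_def complete_graph_def trees_on_def simple_graph_def)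
qed

text \<open>Subtrees are grouped by vertex set and then by its size, with Cayley's formula on each
  set. A constant \<open>f\<close> serves the uniform normaliser, the identity the weighted
  one.\<close>

lemma sum_subtrees_complete_graph:
  fixes f :: "nat \<Rightarrow> real"
  shows "(\<Sum>T\<in>subtrees (complete_graph n). f (card (edges T)))
    = (\<Sum>m=2..n. real (n choose m) * (f (m - 1) * real m ^ (m - 2)))"
proof -
  let ?C = "{V. V \<subseteq> {1..n} \<and> 2 \<le> card V}"
  have fin: "finite V" if "V \<subseteq> {1..n}" for V using that finite_subset by blast
  have "(\<Sum>T\<in>subtrees (complete_graph n). f (card (edges T)))
      = (\<Sum>V\<in>?C. \<Sum>E\<in>trees_on V. f (card E))"
    unfolding subtrees_complete_graph_eq
    by (subst sum.Sigma) (auto simp: case_prod_unfold intro!: finite_trees_on fin)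
  also have "\<dots> = (\<Sum>V\<in>?C. f (card V - 1) * real (card V) ^ (card V - 2))"
  proof (rule sum.cong[OF refl])
    fix V assume V: "V \<in> ?C"
    have "(\<Sum>E\<in>trees_on V. f (card E)) = (\<Sum>E\<in>trees_on V. f (card V - 1))"
      using V fin by (intro sum.cong refl) (auto simp: trees_on_def card_edges_is_tree)
    also have "\<dots> = f (card V - 1) * real (card V) ^ (card V - 2)"
      using cayley_formula[of V] V fin[of V] by (cases "V = {}") auto
    finally show "(\<Sum>E\<in>trees_on V. f (card E)) = f (card V - 1) * real (card V) ^ (card V - 2)" .
  qed
  also have "\<dots> = (\<Sum>m=2..n. \<Sum>V | V \<in> ?C \<and> card V = m. f (card V - 1) * real (card V) ^ (card V - 2))"
    using card_mono[of "{1..n}"] by (intro sum.group[symmetric]) fastforce+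
  also have "\<dots> = (\<Sum>m=2..n. real (n choose m) * (f (m - 1) * real m ^ (m - 2)))"
  proof (rule sum.cong[OF refl])
    fix m assume m: "m \<in> {2..n}"
    then have "{V. V \<in> ?C \<and> card V = m} = {V. V \<subseteq> {1..n} \<and> card V = m}" by auto
    then show "(\<Sum>V | V \<in> ?C \<and> card V = m. f (card V - 1) * real (card V) ^ (card V - 2))
        = real (n choose m) * (f (m - 1) * real m ^ (m - 2))"
      using n_subsets[of "{1..n}" m] by simp
  qed
  finally show ?thesis .
qed

text \<open>Indexing by the number \<open>j = n - m\<close> of omitted vertices makes each term
  converge for fixed \<open>j\<close>.\<close>

lemma sum_subtrees_eq_subtree_ratio:
  fixes f :: "nat \<Rightarrow> real"
  assumes "2 \<le> n"
  shows "(\<Sum>T\<in>subtrees (complete_graph n). f (card (edges T)))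
    = real n ^ (n - 2) * (\<Sum>j\<le>n. f (n - j - 1) * subtree_ratio j n)"
proof -
  have "(\<Sum>T\<in>subtrees (complete_graph n). f (card (edges T)))
      = (\<Sum>j\<le>n - 2. real (n choose j) * (f (n - j - 1) * real (n - j) ^ (n - j - 2)))"
    unfolding sum_subtrees_complete_graph using assms
    by (intro sum.reindex_bij_witness[where i = "\<lambda>j. n - j" and j = "\<lambda>m. n - m"])
       (auto simp: binomial_symmetric[symmetric])
  also have "\<dots> = (\<Sum>j\<le>n - 2. real n ^ (n - 2) * (f (n - j - 1) * subtree_ratio j n))"
    using assms by (intro sum.cong refl) (auto simp: subtree_ratio_def)
  \<comment> \<open>The added indices \<open>n - 1\<close> and \<open>n\<close> contribute 0 by the
    default value of \<open>subtree_ratio\<close>.\<close>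
  also have "\<dots> = (\<Sum>j\<le>n. real n ^ (n - 2) * (f (n - j - 1) * subtree_ratio j n))"
    using assms by (intro sum.mono_neutral_left) (auto simp: subtree_ratio_def)
  finally show ?thesis by (simp add: sum_distrib_left)
qed

section \<open>Both probabilities as reciprocals of weighted ratio sums\<close>

lemma spanning_trees_subset_subtrees:
  "2 \<le> n \<Longrightarrow> spanning_trees (complete_graph n) \<subseteq> subtrees (complete_graph n)"
  by (auto simp: subtrees_complete_graph_eq spanning_trees_complete_graph_eq)

lemma card_spanning_trees_complete_graph:
  "2 \<le> n \<Longrightarrow> card (spanning_trees (complete_graph n)) = n ^ (n - 2)"
  using cayley_formula[of "{1..n}"]
  by (simp add: spanning_trees_complete_graph_eq card_cartesian_product)

lemma prob_spanning_uniform_eq: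
  assumes "2 \<le> n"
  shows "prob_spanning_uniform n = 1 / (\<Sum>j\<le>n. subtree_ratio j n)"
proof -
  have "prob_spanning_uniform n
      = real (card (spanning_trees (complete_graph n))) / real (card (subtrees (complete_graph n)))"
    unfolding prob_spanning_uniform_def
    using spanning_trees_subset_subtrees[OF assms]
    by (subst measure_pmf_of_set)
       (auto simp: finite_subtrees_complete_graph subtrees_complete_graph_nonempty assms Int_absorb1)
  also have "real (card (subtrees (complete_graph n))) = real n ^ (n - 2) * (\<Sum>j\<le>n. subtree_ratio j n)"
    using sum_subtrees_eq_subtree_ratio[OF assms, of "\<lambda>_. 1"] by simp
  finally show ?thesis using assms by (simp add: card_spanning_trees_complete_graph)
qed

text \<open>All spanning trees have the same weight \<open>n - 1\<close>; pulling it out of the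
  normaliser leaves relative weights of at most 1.\<close>

lemma prob_spanning_weighted_eq:
  assumes "2 \<le> n"
  shows "prob_spanning_weighted n
    = 1 / (\<Sum>j\<le>n. (real (n - j - 1) / real (n - 1)) * subtree_ratio j n)"
proof -
  let ?Z = "\<Sum>S\<in>subtrees (complete_graph n). real (card (edges S))"
  let ?R = "\<Sum>j\<le>n. (real (n - j - 1) / real (n - 1)) * subtree_ratio j n"
  have sub: "spanning_trees (complete_graph n) \<subseteq> subtrees (complete_graph n)"
    by (rule spanning_trees_subset_subtrees[OF assms])
  have Z: "?Z = real n ^ (n - 2) * real (n - 1) * ?R"
    unfolding sum_subtrees_eq_subtree_ratio[OF assms, of real] using assms
    by (simp add: sum_distrib_left mult.assoc)
  have "prob_spanning_weighted n = (\<Sum>T\<in>spanning_trees (complete_graph n). real (card (edges T)) / ?Z)"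
    unfolding prob_spanning_weighted_def
    using sub finite_subset[OF sub finite_subtrees_complete_graph]
    by (subst measure_measure_pmf_finite) (auto simp: pmf_subtree_by_edges[OF assms] intro!: sum.cong)
  also have "\<dots> = (\<Sum>T\<in>spanning_trees (complete_graph n). real (n - 1) / ?Z)"
    by (intro sum.cong refl)
       (auto simp: spanning_trees_complete_graph_eq trees_on_def card_edges_is_tree)
  also have "\<dots> = real n ^ (n - 2) * real (n - 1) / ?Z"
    using assms by (simp add: card_spanning_trees_complete_graph)
  finally show ?thesis unfolding Z using assms by simp
qed

theorem theorem1p1:
  shows "prob_spanning_uniform \<longlonglongrightarrow> exp (- exp (-1)) \<and>
         prob_spanning_weighted \<longlonglongrightarrow> exp (- exp (-1)) \<and>
         \<bar>exp (- exp (-1)) - (0.692201 :: real)\<bar> < 0.0000005"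
proof (intro conjI exp_minus_exp_approx)
  \<comment> \<open>Both probabilities are reciprocals of sums tending to
    \<open>exp (exp (-1))\<close>; only the weights differ.\<close>
  have lim: "p \<longlonglongrightarrow> exp (- exp (-1))"
    if w: "\<And>j. (\<lambda>n. w j n) \<longlonglongrightarrow> 1" "\<And>j n. \<bar>w j n\<bar> \<le> 1"
      and p: "\<And>n. 2 \<le> n \<Longrightarrow> p n = 1 / (\<Sum>j\<le>n. w j n * subtree_ratio j n)" for p w
  proof (rule Lim_transform_eventually)
    show "(\<lambda>n. 1 / (\<Sum>j\<le>n. w j n * subtree_ratio j n)) \<longlonglongrightarrow> exp (- exp (-1))"
      unfolding exp_minus[of "exp (-1)"] inverse_eq_divide
      by (intro tendsto_divide tendsto_const sum_subtree_ratio_tendsto w) auto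
    show "\<forall>\<^sub>F n in sequentially. 1 / (\<Sum>j\<le>n. w j n * subtree_ratio j n) = p n"
      using eventually_ge_at_top[of 2] by eventually_elim (simp add: p)
  qed
  show "prob_spanning_uniform \<longlonglongrightarrow> exp (- exp (-1))"
    by (rule lim[of "\<lambda>_ _. 1"]) (simp_all add: prob_spanning_uniform_eq)
  show "prob_spanning_weighted \<longlonglongrightarrow> exp (- exp (-1))"
  proof (rule lim[of "\<lambda>j n. real (n - j - 1) / real (n - 1)"])
    show "(\<lambda>n. real (n - j - 1) / real (n - 1)) \<longlonglongrightarrow> 1" for j
      by real_asymp
    \<comment> \<open>Holds for every \<open>n\<close>: for \<open>n \<le> 1\<close> the quotient is
      0 by division by zero.\<close>
    show "\<bar>real (n - j - 1) / real (n - 1)\<bar> \<le> 1" for j n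
      by (auto simp: divide_le_eq)
  qed (rule prob_spanning_weighted_eq)
qed

end
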